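(* Let $R$ be a commutative, associative, unital ring, let $\{M_{i}:i\in I\}$ be a family of $R$-modules and let $N$, $M$, $A$, $B$, $C$, $S$ and $K$ be $R$-modules. Then the following hold: (1) The direct product $\prod_{i\in I}M_{i}$ is $\text{Red}$-$N$-injective if and only if each $M_{i}$ is $\text{Red}$-$N$-injective. (2) If $S$ is a submodule of $N$ and $M$ is $\text{Red}$-$N$-injective, then $M$ is $\text{Red}$-$S$-injective. (3) If $M\cong N$, then $M$ is $\text{Red}$-$S$-injective if and only if $N$ is $\text{Red}$-$S$-injective. (4) If $A\cong B$, then $C$ is $\text{Red}$-$A$-injective if and only if $C$ is $\text{Red}$-$B$-injective. (5) If $N$ is a direct summand of $M$ and $M$ is $\text{Red}$-$K$-injective, then $N$ is $\text{Red}$-$K$-injective.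
   Context: All modules are unital right $R$-modules. An $R$-module $M$ is reduced if for all $r\in R$ and $m\in M$, $mr^{2}=0$ implies $mr=0$; a submodule is reduced if it is reduced as a module. $\text{Red}(M)$ denotes the sum of all reduced submodules of $M$. A module $M$ is semi-reduced if $\text{Red}(M)=M$; a submodule is semi-reduced if it is so as a module. For $R$-modules $M$ and $N$, $M$ is $\text{Red}$-$N$-injective if for every semi-reduced submodule $K$ of $N$, every $R$-homomorphism $f:K\rightarrow M$ extends to an $R$-homomorphism $N\rightarrow M$. *)

theory Defs
  imports "HOL-Algebra.Module" "HOL-Algebra.AbelCoset"
begin

text \<open>
  Since the base ring is commutative, right modules are the modules of \<^theory>\<open>HOL-Algebra.Module\<close>,
  with the scalar action \<open>m r\<close> written \<open>r \<odot> m\<close>. A submodule is a subset \<open>H\<close> of the carrier of \<open>M\<close>;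
  regarded as a module in its own right it is \<open>M\<lparr>carrier := H\<rparr>\<close>.
\<close>

text \<open>Only the values of a homomorphism on the carrier are constrained.\<close>

definition mod_hom ::
  "('r, 'c) ring_scheme \<Rightarrow> ('r, 'a, 'd) module_scheme \<Rightarrow> ('r, 'b, 'e) module_scheme \<Rightarrow> ('a \<Rightarrow> 'b) set"
  where "mod_hom R M N =
    {f \<in> hom (add_monoid M) (add_monoid N).
       \<forall>r\<in>carrier R. \<forall>x\<in>carrier M. f (r \<odot>\<^bsub>M\<^esub> x) = r \<odot>\<^bsub>N\<^esub> f x}"

definition mod_isomorphic ::
  "('r, 'c) ring_scheme \<Rightarrow> ('r, 'a, 'd) module_scheme \<Rightarrow> ('r, 'b, 'e) module_scheme \<Rightarrow> bool"
  where "mod_isomorphic R M N \<longleftrightarrow>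
    (\<exists>f\<in>mod_hom R M N. bij_betw f (carrier M) (carrier N))"

text \<open>The ring components \<open>mult\<close> and \<open>one\<close> of a module record play no role in the module structure.\<close>

definition product_module ::
  "'i set \<Rightarrow> ('i \<Rightarrow> ('r, 'a, 'd) module_scheme) \<Rightarrow> ('r, 'i \<Rightarrow> 'a) module"
  where "product_module I M =
    \<lparr>carrier = (\<Pi>\<^sub>E i\<in>I. carrier (M i)),
     monoid.mult = (\<lambda>x y. \<lambda>i\<in>I. x i \<otimes>\<^bsub>M i\<^esub> y i),
     one = (\<lambda>i\<in>I. \<one>\<^bsub>M i\<^esub>),
     zero = (\<lambda>i\<in>I. \<zero>\<^bsub>M i\<^esub>),
     add = (\<lambda>x y. \<lambda>i\<in>I. x i \<oplus>\<^bsub>M i\<^esub> y i),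
     smult = (\<lambda>r x. \<lambda>i\<in>I. r \<odot>\<^bsub>M i\<^esub> x i)\<rparr>"

definition direct_summand ::
  "('r, 'c) ring_scheme \<Rightarrow> 'a set \<Rightarrow> ('r, 'a, 'd) module_scheme \<Rightarrow> bool"
  where "direct_summand R H M \<longleftrightarrow>
    submodule H R M \<and>
    (\<exists>L. submodule L R M \<and> H <+>\<^bsub>M\<^esub> L = carrier M \<and> H \<inter> L = {\<zero>\<^bsub>M\<^esub>})"

definition submodule_sum :: "('r, 'a, 'd) module_scheme \<Rightarrow> 'a set set \<Rightarrow> 'a set"
  where "submodule_sum M \<H> =
    {(\<Oplus>\<^bsub>M\<^esub>H\<in>\<F>. x H) | \<F> x. finite \<F> \<and> \<F> \<subseteq> \<H> \<and> (\<forall>H\<in>\<F>. x H \<in> H)}"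

definition reduced_module ::
  "('r, 'c) ring_scheme \<Rightarrow> ('r, 'a, 'd) module_scheme \<Rightarrow> bool"
  where "reduced_module R M \<longleftrightarrow>
    (\<forall>r\<in>carrier R. \<forall>m\<in>carrier M.
       (r [^]\<^bsub>R\<^esub> (2::nat)) \<odot>\<^bsub>M\<^esub> m = \<zero>\<^bsub>M\<^esub> \<longrightarrow> r \<odot>\<^bsub>M\<^esub> m = \<zero>\<^bsub>M\<^esub>)"

definition Red :: "('r, 'c) ring_scheme \<Rightarrow> ('r, 'a, 'd) module_scheme \<Rightarrow> 'a set"
  where "Red R M =
    submodule_sum M {H. submodule H R M \<and> reduced_module R (M\<lparr>carrier := H\<rparr>)}"

definition semi_reduced ::
  "('r, 'c) ring_scheme \<Rightarrow> ('r, 'a, 'd) module_scheme \<Rightarrow> bool"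
  where "semi_reduced R M \<longleftrightarrow> Red R M = carrier M"

text \<open>\<open>Red_injective R N M\<close> means that \<open>M\<close> is Red-\<open>N\<close>-injective.\<close>

definition Red_injective ::
  "('r, 'c) ring_scheme \<Rightarrow> ('r, 'a, 'd) module_scheme \<Rightarrow> ('r, 'b, 'e) module_scheme \<Rightarrow> bool"
  where "Red_injective R N M \<longleftrightarrow>
    (\<forall>K. submodule K R N \<and> semi_reduced R (N\<lparr>carrier := K\<rparr>) \<longrightarrow>
      (\<forall>f\<in>mod_hom R (N\<lparr>carrier := K\<rparr>) M. \<exists>g\<in>mod_hom R N M. \<forall>x\<in>K. g x = f x))"

end

theory Submission
  imports Defs
begin

text \<open>
  Every part concerns extending a homomorphism from a semi-reduced submodule. A retract of a
  Red-\<open>K\<close>-injective module is Red-\<open>K\<close>-injective: compose with the section, extend, and compose with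
  the retraction. Factors of a product, isomorphic copies and direct summands are all retracts.
  Change of the domain along an isomorphism only needs that semi-reducedness is invariant under
  isomorphism, because the image of a sum of reduced submodules is a sum of reduced submodules.
\<close>

section \<open>Module homomorphisms\<close>

lemma mod_homI:
  assumes "\<And>x. x \<in> carrier M \<Longrightarrow> f x \<in> carrier N"
    and "\<And>x y. \<lbrakk>x \<in> carrier M; y \<in> carrier M\<rbrakk> \<Longrightarrow> f (x \<oplus>\<^bsub>M\<^esub> y) = f x \<oplus>\<^bsub>N\<^esub> f y"
    and "\<And>r x. \<lbrakk>r \<in> carrier R; x \<in> carrier M\<rbrakk> \<Longrightarrow> f (r \<odot>\<^bsub>M\<^esub> x) = r \<odot>\<^bsub>N\<^esub> f x"
  shows "f \<in> mod_hom R M N"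
  using assms by (auto simp: mod_hom_def hom_def)

lemma mod_homD:
  assumes "f \<in> mod_hom R M N"
  shows "x \<in> carrier M \<Longrightarrow> f x \<in> carrier N"
    and "\<lbrakk>x \<in> carrier M; y \<in> carrier M\<rbrakk> \<Longrightarrow> f (x \<oplus>\<^bsub>M\<^esub> y) = f x \<oplus>\<^bsub>N\<^esub> f y"
    and "\<lbrakk>r \<in> carrier R; x \<in> carrier M\<rbrakk> \<Longrightarrow> f (r \<odot>\<^bsub>M\<^esub> x) = r \<odot>\<^bsub>N\<^esub> f x"
  using assms by (auto simp: mod_hom_def hom_def)

lemma mod_hom_comp:
  assumes f: "f \<in> mod_hom R L M" and g: "g \<in> mod_hom R M N"
  shows "(\<lambda>x. g (f x)) \<in> mod_hom R L N"
  by (rule mod_homI) (simp_all add: mod_homD[OF f] mod_homD[OF g])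

lemma mod_hom_restrict:
  assumes "f \<in> mod_hom R M N" "H \<subseteq> carrier M"
  shows "f \<in> mod_hom R (M\<lparr>carrier := H\<rparr>) N"
  by (rule mod_homI) (use assms(2) in \<open>auto simp: subset_iff mod_homD[OF assms(1)]\<close>)

lemma mod_hom_codomain:
  assumes "f \<in> mod_hom R M N" "f ` carrier M \<subseteq> H"
  shows "f \<in> mod_hom R M (N\<lparr>carrier := H\<rparr>)"
  by (rule mod_homI) (use assms(2) in \<open>auto simp: mod_homD[OF assms(1)]\<close>)

lemma mod_hom_zero:
  assumes "module R M" "module R N" "f \<in> mod_hom R M N"
  shows "f \<zero>\<^bsub>M\<^esub> = \<zero>\<^bsub>N\<^esub>"
proof -
  interpret M: module R M by fact
  interpret N: module R N by fact
  \<comment> \<open>Zero is the zero scalar times zero, so compatibility with scalars already forces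
    the claim. Negatives are treated the same way with the scalar -1.\<close>
  have "f \<zero>\<^bsub>M\<^esub> = f (\<zero>\<^bsub>R\<^esub> \<odot>\<^bsub>M\<^esub> \<zero>\<^bsub>M\<^esub>)" by simp
  also have "\<dots> = \<zero>\<^bsub>R\<^esub> \<odot>\<^bsub>N\<^esub> f \<zero>\<^bsub>M\<^esub>"
    by (rule mod_homD(3)[OF assms(3)]) simp_all
  also have "\<dots> = \<zero>\<^bsub>N\<^esub>" using mod_homD(1)[OF assms(3)] by simp
  finally show ?thesis .
qed

lemma mod_hom_a_inv:
  assumes "module R M" "module R N" "f \<in> mod_hom R M N" "x \<in> carrier M"
  shows "f (\<ominus>\<^bsub>M\<^esub> x) = \<ominus>\<^bsub>N\<^esub> f x"
proof -
  interpret M: module R M by fact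
  interpret N: module R N by fact
  have "f (\<ominus>\<^bsub>M\<^esub> x) = f ((\<ominus>\<^bsub>R\<^esub> \<one>\<^bsub>R\<^esub>) \<odot>\<^bsub>M\<^esub> x)"
    using assms(4) by (simp add: M.smult_l_minus)
  also have "\<dots> = \<ominus>\<^bsub>N\<^esub> f x"
    using mod_homD[OF assms(3)] assms(4) by (simp add: N.smult_l_minus)
  finally show ?thesis .
qed

lemma mod_hom_finsum:
  assumes "module R M" "module R N" "f \<in> mod_hom R M N"
    and "finite F" "\<And>i. i \<in> F \<Longrightarrow> x i \<in> carrier M"
  shows "f (\<Oplus>\<^bsub>M\<^esub>i\<in>F. x i) = (\<Oplus>\<^bsub>N\<^esub>i\<in>F. f (x i))"
proof -
  interpret M: module R M by fact
  interpret N: module R N by fact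
  show ?thesis
    using assms(4,5)
  proof (induction F)
    case empty
    then show ?case using mod_hom_zero[OF assms(1-3)] by simp
  next
    case (insert i F)
    then show ?case
      by (simp add: mod_homD[OF assms(3)] M.finsum_closed Pi_def)
  qed
qed

lemma mod_hom_inv_into:
  assumes "module R M" "f \<in> mod_hom R M N" "bij_betw f (carrier M) (carrier N)"
  shows "inv_into (carrier M) f \<in> mod_hom R N M"
proof -
  interpret M: module R M by fact
  let ?g = "inv_into (carrier M) f"
  have inj: "inj_on f (carrier M)" and surj: "f ` carrier M = carrier N"
    using assms(3) by (auto simp: bij_betw_def)
  have g: "?g y \<in> carrier M" "f (?g y) = y" if "y \<in> carrier N" for y
    using that surj by (auto intro: inv_into_into f_inv_into_f)
  show ?thesis
  proof (rule mod_homI)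
    fix x y assume "x \<in> carrier N" "y \<in> carrier N"
    then show "?g (x \<oplus>\<^bsub>N\<^esub> y) = ?g x \<oplus>\<^bsub>M\<^esub> ?g y"
      \<comment> \<open>The element \<open>?g x \<oplus> ?g y\<close> of M is sent by f to
        \<open>x \<oplus> y\<close>, so by injectivity it is the preimage of that sum. Scalar
        multiples follow the same pattern.\<close>
      using inv_into_f_f[OF inj, of "?g x \<oplus>\<^bsub>M\<^esub> ?g y"] g mod_homD(2)[OF assms(2)] by simp
  next
    fix r x assume "r \<in> carrier R" "x \<in> carrier N"
    then show "?g (r \<odot>\<^bsub>N\<^esub> x) = r \<odot>\<^bsub>M\<^esub> ?g x"
      using inv_into_f_f[OF inj, of "r \<odot>\<^bsub>M\<^esub> ?g x"] g mod_homD(3)[OF assms(2)] by simp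
  qed (use g in simp)
qed

lemma mod_isomorphic_sym:
  assumes "module R M" "mod_isomorphic R M N"
  shows "mod_isomorphic R N M"
  using assms mod_hom_inv_into bij_betw_inv_into unfolding mod_isomorphic_def by metis

lemma submodule_image:
  assumes "module R M" "module R N" "f \<in> mod_hom R M N" "submodule H R M"
  shows "submodule (f ` H) R N"
proof -
  interpret M: module R M by fact
  interpret N: module R N by fact
  note H = M.submoduleE[OF assms(4)]
  have H0: "\<zero>\<^bsub>M\<^esub> \<in> H"
    using subgroup.one_closed[OF submodule.axioms(1)[OF assms(4)]] by simp
  have sub: "x \<in> carrier M" if "x \<in> H" for x
    using H(1) that by blast
  show ?thesis
  proof (rule N.submoduleI)
    show "f ` H \<subseteq> carrier N" using sub mod_homD(1)[OF assms(3)] by blast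
    show "\<zero>\<^bsub>N\<^esub> \<in> f ` H" using H0 mod_hom_zero[OF assms(1-3)] by (metis imageI)
    \<comment> \<open>Read from right to left, the homomorphism laws turn an operation on images
      into the image of an operation inside H, where closure is known.\<close>
    show "\<ominus>\<^bsub>N\<^esub> a \<in> f ` H" if "a \<in> f ` H" for a
      using that sub by (auto simp: mod_hom_a_inv[OF assms(1-3), symmetric] intro: H(3))
    show "a \<oplus>\<^bsub>N\<^esub> b \<in> f ` H" if "a \<in> f ` H" "b \<in> f ` H" for a b
      using that sub by (auto simp: mod_homD(2)[OF assms(3), symmetric] intro: H(5))
    show "r \<odot>\<^bsub>N\<^esub> x \<in> f ` H" if "r \<in> carrier R" "x \<in> f ` H" for r x
      using that sub by (auto simp: mod_homD(3)[OF assms(3), symmetric] intro: H(4))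
  qed
qed

section \<open>Semi-reduced modules\<close>

text \<open>Injectivity is what carries reducedness over: if r^2 kills f h, then f sends r^2 h to
  zero, so r^2 h = 0. Reducedness of H gives r h = 0, and applying f finishes.\<close>

lemma reduced_module_image:
  assumes "module R M" "module R N" "f \<in> mod_hom R M N" "inj_on f (carrier M)"
    and "submodule H R M" "reduced_module R (M\<lparr>carrier := H\<rparr>)"
  shows "reduced_module R (N\<lparr>carrier := f ` H\<rparr>)"
  unfolding reduced_module_def
proof (intro ballI impI)
  interpret M: module R M by fact
  interpret N: module R N by fact
  note f = mod_homD[OF assms(3)]
  fix r m assume r: "r \<in> carrier R" and m: "m \<in> carrier (N\<lparr>carrier := f ` H\<rparr>)"
    and eq: "(r [^]\<^bsub>R\<^esub> (2::nat)) \<odot>\<^bsub>N\<lparr>carrier := f ` H\<rparr>\<^esub> m = \<zero>\<^bsub>N\<lparr>carrier := f ` H\<rparr>\<^esub>"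
  from m obtain h where h: "h \<in> H" "m = f h" by auto
  have hM: "h \<in> carrier M" using M.submoduleE(1)[OF assms(5)] h by blast
  have "f ((r [^]\<^bsub>R\<^esub> (2::nat)) \<odot>\<^bsub>M\<^esub> h) = f \<zero>\<^bsub>M\<^esub>"
    using eq h(2) r hM f(3) mod_hom_zero[OF assms(1-3)] by simp
  then have "(r [^]\<^bsub>R\<^esub> (2::nat)) \<odot>\<^bsub>M\<^esub> h = \<zero>\<^bsub>M\<^esub>"
    using inj_onD[OF assms(4)] r hM by simp
  then have "r \<odot>\<^bsub>M\<^esub> h = \<zero>\<^bsub>M\<^esub>"
    using assms(6) r h(1) by (simp add: reduced_module_def)
  then show "r \<odot>\<^bsub>N\<lparr>carrier := f ` H\<rparr>\<^esub> m = \<zero>\<^bsub>N\<lparr>carrier := f ` H\<rparr>\<^esub>"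
    using f(3)[OF r hM] h(2) mod_hom_zero[OF assms(1-3)] by simp
qed

lemma Red_subset_carrier:
  assumes "module R M"
  shows "Red R M \<subseteq> carrier M"
proof -
  interpret M: module R M by fact
  show ?thesis
    unfolding Red_def submodule_sum_def
    using M.submoduleE(1) by (auto intro!: M.finsum_closed)
qed

lemma Red_image_subset:
  assumes "module R M" "module R N" "f \<in> mod_hom R M N" "inj_on f (carrier M)"
  shows "f ` Red R M \<subseteq> Red R N"
proof
  interpret M: module R M by fact
  interpret N: module R N by fact
  fix y assume "y \<in> f ` Red R M"
  then obtain \<F> x where fin: "finite \<F>"
    and \<F>: "\<And>H. H \<in> \<F> \<Longrightarrow> submodule H R M \<and> reduced_module R (M\<lparr>carrier := H\<rparr>)"
    and x: "\<And>H. H \<in> \<F> \<Longrightarrow> x H \<in> H"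
    and y: "y = f (\<Oplus>\<^bsub>M\<^esub>H\<in>\<F>. x H)"
    by (auto simp: Red_def submodule_sum_def)
  have sub: "H \<subseteq> carrier M" if "H \<in> \<F>" for H
    using \<F>[OF that] M.submoduleE(1) by blast
  \<comment> \<open>The summands are indexed by the submodules themselves, so reindexing the sum by
    image submodules requires distinct submodules to have distinct images.\<close>
  have inj: "inj_on ((`) f) \<F>"
    using inj_on_image_eq_iff[OF assms(4)] sub by (meson inj_onI)
  \<comment> \<open>For an image submodule, \<open>x'\<close> returns the f-image of the summand
    chosen in its unique preimage within \<open>\<F>\<close>.\<close>
  define x' where "x' = (\<lambda>H. f (x (inv_into \<F> ((`) f) H)))"
  have x': "x' (f ` H) = f (x H)" if "H \<in> \<F>" for H
    using that inj by (simp add: x'_def)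
  have fx: "f (x H) \<in> carrier N" if "H \<in> \<F>" for H
    using that sub x mod_homD(1)[OF assms(3)] by blast
  have "y = (\<Oplus>\<^bsub>N\<^esub>H\<in>\<F>. f (x H))"
    using y mod_hom_finsum[OF assms(1-3) fin, of x] sub x by blast
  also have "\<dots> = (\<Oplus>\<^bsub>N\<^esub>H\<in>\<F>. x' (f ` H))"
    using x' fx by (intro N.finsum_cong') auto
  also have "\<dots> = (\<Oplus>\<^bsub>N\<^esub>H\<in>(`) f ` \<F>. x' H)"
    using inj x' fx by (intro N.finsum_reindex[symmetric]) auto
  finally have "y = (\<Oplus>\<^bsub>N\<^esub>H\<in>(`) f ` \<F>. x' H)" .
  moreover have "submodule (f ` H) R N \<and> reduced_module R (N\<lparr>carrier := f ` H\<rparr>)"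
    if "H \<in> \<F>" for H
    using \<F>[OF that] submodule_image[OF assms(1-3)] reduced_module_image[OF assms] by blast
  moreover have "\<forall>H\<in>(`) f ` \<F>. x' H \<in> H"
    using x x' by auto
  ultimately show "y \<in> Red R N"
    unfolding Red_def submodule_sum_def using fin by blast
qed

text \<open>One inclusion holds in every module. For the other, \<open>Red R N\<close> contains the
  image of \<open>Red R M\<close>, which is the image of the whole carrier of M and hence all of
  N.\<close>

lemma semi_reduced_image:
  assumes "module R M" "module R N" "f \<in> mod_hom R M N" "bij_betw f (carrier M) (carrier N)"
    and "semi_reduced R M"
  shows "semi_reduced R N"
  using Red_subset_carrier[OF assms(2)] Red_image_subset[OF assms(1-3)] assms(4,5)
  unfolding semi_reduced_def bij_betw_def by auto

section \<open>Red-injectivity\<close>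

lemma Red_injectiveD:
  assumes "Red_injective R N M" "submodule K R N" "semi_reduced R (N\<lparr>carrier := K\<rparr>)"
    and "f \<in> mod_hom R (N\<lparr>carrier := K\<rparr>) M"
  obtains g where "g \<in> mod_hom R N M" "\<And>x. x \<in> K \<Longrightarrow> g x = f x"
  using assms unfolding Red_injective_def by blast

section \<open>Retracts and isomorphic copies of the codomain\<close>

lemma Red_injective_retract:
  assumes inj: "Red_injective R K M"
    and s: "s \<in> mod_hom R N M" and p: "p \<in> mod_hom R M N"
    and ps: "\<And>x. x \<in> carrier N \<Longrightarrow> p (s x) = x"
  shows "Red_injective R K N"
  unfolding Red_injective_def
proof (intro allI impI ballI)
  fix H f
  assume H: "submodule H R K \<and> semi_reduced R (K\<lparr>carrier := H\<rparr>)"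
    and f: "f \<in> mod_hom R (K\<lparr>carrier := H\<rparr>) N"
  obtain g where g: "g \<in> mod_hom R K M" "\<And>x. x \<in> H \<Longrightarrow> g x = s (f x)"
    using Red_injectiveD[OF inj _ _ mod_hom_comp[OF f s]] H by blast
  \<comment> \<open>The witness is p after g: on H it equals \<open>p (s (f x))\<close>, which is
    \<open>f x\<close> by \<open>ps\<close>.\<close>
  show "\<exists>h\<in>mod_hom R K N. \<forall>x\<in>H. h x = f x"
    by (rule bexI[OF _ mod_hom_comp[OF g(1) p]]) (use g(2) ps mod_homD(1)[OF f] in simp)
qed

lemma Red_injective_codomain_iso:
  assumes "module R M" "mod_isomorphic R M N" "Red_injective R K M"
  shows "Red_injective R K N"
proof -
  obtain f where f: "f \<in> mod_hom R M N" "bij_betw f (carrier M) (carrier N)"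
    using assms(2) by (auto simp: mod_isomorphic_def)
  show ?thesis
    \<comment> \<open>The inverse of f is the section and f itself the retraction.\<close>
    using Red_injective_retract[OF assms(3) mod_hom_inv_into[OF assms(1) f] f(1)]
      bij_betw_inv_into_right[OF f(2)] by blast
qed

section \<open>Change of the domain along isomorphisms and to submodules\<close>

lemma Red_injective_domain_iso:
  assumes A: "module R A" and B: "module R B"
    and iso: "mod_isomorphic R B A" and inj: "Red_injective R A C"
  shows "Red_injective R B C"
  unfolding Red_injective_def
proof (intro allI impI ballI)
  fix K h
  assume K: "submodule K R B \<and> semi_reduced R (B\<lparr>carrier := K\<rparr>)"
    and h: "h \<in> mod_hom R (B\<lparr>carrier := K\<rparr>) C"
  obtain g where g: "g \<in> mod_hom R B A" "bij_betw g (carrier B) (carrier A)"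
    using iso by (auto simp: mod_isomorphic_def)
  let ?f = "inv_into (carrier B) g"
  have KB: "K \<subseteq> carrier B" using module.submoduleE(1)[OF B] K by blast
  have fg: "?f (g x) = x" if "x \<in> K" for x
    using that KB bij_betw_inv_into_left[OF g(2)] by blast
  have gK: "submodule (g ` K) R A"
    using submodule_image[OF B A g(1)] K by blast
  have gKA: "g ` K \<subseteq> carrier A" using module.submoduleE(1)[OF A gK] .
  have "bij_betw g (carrier (B\<lparr>carrier := K\<rparr>)) (carrier (A\<lparr>carrier := g ` K\<rparr>))"
    \<comment> \<open>Cut down to K and its image, g is still an isomorphism, so the image inherits
      semi-reducedness and is an admissible test submodule of A.\<close>
    using g(2) KB by (auto intro: inj_on_imp_bij_betw inj_on_subset simp: bij_betw_def)
  moreover have "g \<in> mod_hom R (B\<lparr>carrier := K\<rparr>) (A\<lparr>carrier := g ` K\<rparr>)"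
    by (rule mod_hom_codomain[OF mod_hom_restrict[OF g(1) KB]]) simp
  ultimately have sr: "semi_reduced R (A\<lparr>carrier := g ` K\<rparr>)"
    using semi_reduced_image submodule.submodule_is_module A B K gK by metis
  have "?f \<in> mod_hom R (A\<lparr>carrier := g ` K\<rparr>) (B\<lparr>carrier := K\<rparr>)"
    using fg by (intro mod_hom_codomain mod_hom_restrict[OF mod_hom_inv_into[OF B g] gKA]) auto
  from Red_injectiveD[OF inj gK sr mod_hom_comp[OF this h]]
  obtain k where k: "k \<in> mod_hom R A C" "\<And>y. y \<in> g ` K \<Longrightarrow> k y = h (?f y)"
    by blast
  \<comment> \<open>The witness is k after g: for x in K it gives \<open>h (?f (g x))\<close>, which
    is \<open>h x\<close>.\<close>
  show "\<exists>k\<in>mod_hom R B C. \<forall>x\<in>K. k x = h x"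
    by (rule bexI[OF _ mod_hom_comp[OF g(1) k(1)]]) (use k(2) fg in simp)
qed

text \<open>A semi-reduced submodule K of H is also one of N, with the same induced structure. So a
  map on K extends to N, and restricting that extension to H suffices.\<close>

lemma Red_injective_submodule:
  assumes "module R N" "submodule H R N" "Red_injective R N M"
  shows "Red_injective R (N\<lparr>carrier := H\<rparr>) M"
  unfolding Red_injective_def
proof (intro allI impI ballI)
  interpret N: module R N by fact
  interpret H: module R "N\<lparr>carrier := H\<rparr>"
    using submodule.submodule_is_module[OF assms(2,1)] .
  have HN: "H \<subseteq> carrier N" using N.submoduleE(1)[OF assms(2)] .
  fix K f
  assume K: "submodule K R (N\<lparr>carrier := H\<rparr>) \<and>
      semi_reduced R (N\<lparr>carrier := H, carrier := K\<rparr>)"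
    and f: "f \<in> mod_hom R (N\<lparr>carrier := H, carrier := K\<rparr>) M"
  have "K \<subseteq> H" using H.submoduleE(1)[of K] K by simp
  \<comment> \<open>Transitivity of submodules goes through modules: the second carrier update
    overrides the first, so K is a module under the operations of N, and it lies inside N.\<close>
  moreover have "module R (N\<lparr>carrier := K\<rparr>)"
    using submodule.submodule_is_module[OF conjunct1[OF K] H.module_axioms] by simp
  ultimately have "submodule K R N"
    using N.module_incl_imp_submodule[OF subset_trans[OF _ HN]] by simp
  then obtain g where "g \<in> mod_hom R N M" "\<And>x. x \<in> K \<Longrightarrow> g x = f x"
    by (rule Red_injectiveD[OF assms(3), of K f]) (use K f in simp_all)
  then show "\<exists>g\<in>mod_hom R (N\<lparr>carrier := H\<rparr>) M. \<forall>x\<in>K. g x = f x"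
    using mod_hom_restrict[OF _ HN] by blast
qed

section \<open>Direct summands\<close>

lemma direct_summand_projection:
  assumes "module R M" "direct_summand R H M"
  obtains p where "p \<in> mod_hom R M (M\<lparr>carrier := H\<rparr>)" "\<And>h. h \<in> H \<Longrightarrow> p h = h"
proof -
  interpret M: module R M by fact
  obtain L where sH: "submodule H R M" and sL: "submodule L R M"
    and sum: "H <+>\<^bsub>M\<^esub> L = carrier M" and int: "H \<inter> L = {\<zero>\<^bsub>M\<^esub>}"
    using assms(2) by (auto simp: direct_summand_def)
  note H = M.submoduleE[OF sH] and L = M.submoduleE[OF sL]
  have HM: "x \<in> carrier M" if "x \<in> H" for x using H(1) that by blast
  have LM: "x \<in> carrier M" if "x \<in> L" for x using L(1) that by blast
  have ex: "\<exists>h\<in>H. \<exists>l\<in>L. m = h \<oplus>\<^bsub>M\<^esub> l" if "m \<in> carrier M" for m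
    using that sum unfolding set_add_def' by blast
  \<comment> \<open>Two decompositions of one element give h - h' = l' - l. The left side lies in H
    and the right side in L, so both are zero.\<close>
  have uniq: "h = h'" if "h \<in> H" "h' \<in> H" "l \<in> L" "l' \<in> L" "h \<oplus>\<^bsub>M\<^esub> l = h' \<oplus>\<^bsub>M\<^esub> l'" for h h' l l'
  proof -
    have c: "h \<in> carrier M" "h' \<in> carrier M" "l \<in> carrier M" "l' \<in> carrier M"
      using that HM LM by auto
    \<comment> \<open>Adding and subtracting l exposes the sum h + l, which the next step replaces
      by h' + l'.\<close>
    have "h \<oplus>\<^bsub>M\<^esub> \<ominus>\<^bsub>M\<^esub> h' = (h \<oplus>\<^bsub>M\<^esub> l) \<oplus>\<^bsub>M\<^esub> (\<ominus>\<^bsub>M\<^esub> l \<oplus>\<^bsub>M\<^esub> \<ominus>\<^bsub>M\<^esub> h')"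
      using c by (simp add: M.a_assoc M.r_neg2)
    also have "\<dots> = l' \<oplus>\<^bsub>M\<^esub> \<ominus>\<^bsub>M\<^esub> l"
      unfolding that(5) using c
      by (simp add: M.a_comm[of h' l'] M.a_comm[of "\<ominus>\<^bsub>M\<^esub> l"] M.a_assoc M.r_neg2)
    finally have eq: "h \<oplus>\<^bsub>M\<^esub> \<ominus>\<^bsub>M\<^esub> h' = l' \<oplus>\<^bsub>M\<^esub> \<ominus>\<^bsub>M\<^esub> l" .
    moreover have "h \<oplus>\<^bsub>M\<^esub> \<ominus>\<^bsub>M\<^esub> h' \<in> H" "l' \<oplus>\<^bsub>M\<^esub> \<ominus>\<^bsub>M\<^esub> l \<in> L"
      using that H(3,5) L(3,5) by auto
    ultimately have "h \<oplus>\<^bsub>M\<^esub> \<ominus>\<^bsub>M\<^esub> h' = \<zero>\<^bsub>M\<^esub>" using int by auto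
    then show ?thesis using c by (metis M.minus_equality M.minus_minus M.add.inv_closed M.a_comm)
  qed
  \<comment> \<open>The description is well defined by \<open>ex\<close> and \<open>uniq\<close>.
    Afterwards p is handled only through its value on a sum of an element of H and one of L.\<close>
  define p where "p m = (THE h. h \<in> H \<and> (\<exists>l\<in>L. m = h \<oplus>\<^bsub>M\<^esub> l))" for m
  have p: "p (h \<oplus>\<^bsub>M\<^esub> l) = h" if "h \<in> H" "l \<in> L" for h l
    unfolding p_def using that uniq by (intro the_equality) blast+
  have "p \<in> mod_hom R M (M\<lparr>carrier := H\<rparr>)"
  proof (rule mod_homI)
    fix x assume "x \<in> carrier M"
    then obtain h l where x: "h \<in> H" "l \<in> L" "x = h \<oplus>\<^bsub>M\<^esub> l" using ex by blast
    then show "p x \<in> carrier (M\<lparr>carrier := H\<rparr>)" using p by simp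
    fix r assume r: "r \<in> carrier R"
    \<comment> \<open>Scaling a decomposition of x yields one of the scaled element, so its
      H-component can be read off. Sums are treated likewise below.\<close>
    then have "r \<odot>\<^bsub>M\<^esub> x = r \<odot>\<^bsub>M\<^esub> h \<oplus>\<^bsub>M\<^esub> r \<odot>\<^bsub>M\<^esub> l"
      using x HM LM by (simp add: M.smult_r_distr)
    then show "p (r \<odot>\<^bsub>M\<^esub> x) = r \<odot>\<^bsub>M\<lparr>carrier := H\<rparr>\<^esub> p x"
      using p x r H(4) L(4) by simp
  next
    fix x y assume "x \<in> carrier M" "y \<in> carrier M"
    then obtain h l h' l' where x: "h \<in> H" "l \<in> L" "x = h \<oplus>\<^bsub>M\<^esub> l"
      and y: "h' \<in> H" "l' \<in> L" "y = h' \<oplus>\<^bsub>M\<^esub> l'"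
      using ex by meson
    have "x \<oplus>\<^bsub>M\<^esub> y = (h \<oplus>\<^bsub>M\<^esub> h') \<oplus>\<^bsub>M\<^esub> (l \<oplus>\<^bsub>M\<^esub> l')"
      using x y HM LM by (simp add: M.a_ac)
    then show "p (x \<oplus>\<^bsub>M\<^esub> y) = p x \<oplus>\<^bsub>M\<lparr>carrier := H\<rparr>\<^esub> p y"
      using p x y H(5) L(5) by simp
  qed
  moreover have "p h = h" if "h \<in> H" for h
    \<comment> \<open>An element h of H decomposes as h + 0, where 0 belongs to L.\<close>
    using p[OF that, of "\<zero>\<^bsub>M\<^esub>"] int HM[OF that] by auto
  ultimately show ?thesis using that by blast
qed

lemma Red_injective_direct_summand:
  assumes "module R M" "direct_summand R H M" "Red_injective R K M"
  shows "Red_injective R K (M\<lparr>carrier := H\<rparr>)"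
proof -
  obtain p where p: "p \<in> mod_hom R M (M\<lparr>carrier := H\<rparr>)" "\<And>h. h \<in> H \<Longrightarrow> p h = h"
    by (rule direct_summand_projection[OF assms(1,2)]) blast
  have "H \<subseteq> carrier M"
    using assms(2) module.submoduleE(1)[OF assms(1)] by (simp add: direct_summand_def)
  \<comment> \<open>The inclusion of H is the section and the projection p the retraction.\<close>
  then have "(\<lambda>x. x) \<in> mod_hom R (M\<lparr>carrier := H\<rparr>) M"
    by (intro mod_homI) auto
  from Red_injective_retract[OF assms(3) this p(1)] show ?thesis using p(2) by simp
qed

section \<open>Direct products\<close>

lemma product_module_proj:
  assumes "i \<in> I"
  shows "(\<lambda>x. x i) \<in> mod_hom R (product_module I M) (M i)"
  using assms by (intro mod_homI) (auto simp: product_module_def)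

text \<open>The existence half of the universal property of the product. Restricting to I puts the
  tuple into the extensional carrier.\<close>

lemma product_module_tuple:
  assumes "\<And>i. i \<in> I \<Longrightarrow> f i \<in> mod_hom R N (M i)"
  shows "(\<lambda>x. \<lambda>i\<in>I. f i x) \<in> mod_hom R N (product_module I M)"
  by (rule mod_homI)
    (auto simp: product_module_def restrict_def fun_eq_iff mod_homD[OF assms])

lemma mod_hom_zero_map:
  assumes "module R M"
  shows "(\<lambda>x. \<zero>\<^bsub>M\<^esub>) \<in> mod_hom R N M"
proof -
  interpret M: module R M by fact
  show ?thesis by (rule mod_homI) auto
qed

lemma Red_injective_product_iff:
  assumes "\<And>i. i \<in> I \<Longrightarrow> module R (M i)"
  shows "Red_injective R N (product_module I M) \<longleftrightarrow> (\<forall>i\<in>I. Red_injective R N (M i))"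
proof
  assume inj: "Red_injective R N (product_module I M)"
  show "\<forall>i\<in>I. Red_injective R N (M i)"
  proof
    fix i assume i: "i \<in> I"
    \<comment> \<open>The tuple of these maps embeds the factor \<open>M i\<close> into the product,
      with zero in every other coordinate. The i-th projection is a left inverse, so the factor is a
      retract.\<close>
    have "(\<lambda>x. if j = i then x else \<zero>\<^bsub>M j\<^esub>) \<in> mod_hom R (M i) (M j)" if "j \<in> I" for j
      using mod_hom_zero_map[OF assms[OF that], of "M i"] by (cases "j = i") (auto intro: mod_homI)
    from Red_injective_retract[OF inj product_module_tuple[OF this] product_module_proj[OF i]]
    show "Red_injective R N (M i)" using i by simp
  qed
next
  assume inj: "\<forall>i\<in>I. Red_injective R N (M i)"
  show "Red_injective R N (product_module I M)"
    unfolding Red_injective_def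
  proof (intro allI impI ballI)
    fix K f
    assume K: "submodule K R N \<and> semi_reduced R (N\<lparr>carrier := K\<rparr>)"
      and f: "f \<in> mod_hom R (N\<lparr>carrier := K\<rparr>) (product_module I M)"
    \<comment> \<open>Each coordinate of f is extended separately. One extension per index is then
      chosen, and the choices are assembled into a tuple.\<close>
    have "\<exists>g. g \<in> mod_hom R N (M i) \<and> (\<forall>x\<in>K. g x = f x i)" if "i \<in> I" for i
      using Red_injectiveD[OF _ _ _ mod_hom_comp[OF f product_module_proj[OF that]]] inj K that
      by metis
    then obtain g where g: "\<And>i. i \<in> I \<Longrightarrow> g i \<in> mod_hom R N (M i)"
        "\<And>i x. i \<in> I \<Longrightarrow> x \<in> K \<Longrightarrow> g i x = f x i"
      by metis
    \<comment> \<open>Equality of total functions also concerns indices outside I; there both sides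
      are \<open>undefined\<close>, because \<open>f x\<close> lies in the extensional
      product.\<close>
    have "(\<lambda>i\<in>I. g i x) = f x" if "x \<in> K" for x
    proof -
      have "f x \<in> (\<Pi>\<^sub>E i\<in>I. carrier (M i))"
        using mod_homD(1)[OF f, of x] that by (simp add: product_module_def)
      then show ?thesis using g(2) that by (auto simp: fun_eq_iff restrict_def PiE_def extensional_def)
    qed
    then show "\<exists>g\<in>mod_hom R N (product_module I M). \<forall>x\<in>K. g x = f x"
      by (intro bexI[OF _ product_module_tuple[OF g(1)]]) simp_all
  qed
qed

theorem theorem1:
  fixes R :: "('r, 'z) ring_scheme"
    and I :: "'i set"
    and Mi :: "'i \<Rightarrow> ('r, 'p, 'z1) module_scheme"
    and N :: "('r, 'n, 'z2) module_scheme"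
    and M :: "('r, 'm, 'z3) module_scheme"
    and A :: "('r, 'a, 'z4) module_scheme"
    and B :: "('r, 'b, 'z5) module_scheme"
    and C :: "('r, 'c, 'z6) module_scheme"
    and S :: "('r, 's, 'z7) module_scheme"
    and K :: "('r, 'k, 'z8) module_scheme"
  assumes "cring R"
    and "\<And>i. i \<in> I \<Longrightarrow> module R (Mi i)"
    and "module R N" and "module R M"
    and "module R A" and "module R B" and "module R C"
    and "module R S" and "module R K"
  shows "(Red_injective R N (product_module I Mi) \<longleftrightarrow> (\<forall>i\<in>I. Red_injective R N (Mi i))) \<and>
    (\<forall>H. submodule H R N \<longrightarrow> Red_injective R N M \<longrightarrow> Red_injective R (N\<lparr>carrier := H\<rparr>) M) \<and>
    (mod_isomorphic R M N \<longrightarrow> (Red_injective R S M \<longleftrightarrow> Red_injective R S N)) \<and>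
    (mod_isomorphic R A B \<longrightarrow> (Red_injective R A C \<longleftrightarrow> Red_injective R B C)) \<and>
    (\<forall>H. direct_summand R H M \<longrightarrow> Red_injective R K M \<longrightarrow> Red_injective R K (M\<lparr>carrier := H\<rparr>))"
proof (intro conjI allI impI)
  show "Red_injective R N (product_module I Mi) \<longleftrightarrow> (\<forall>i\<in>I. Red_injective R N (Mi i))"
    by (rule Red_injective_product_iff[OF assms(2)])
next
  fix H assume "submodule H R N" "Red_injective R N M"
  then show "Red_injective R (N\<lparr>carrier := H\<rparr>) M"
    by (rule Red_injective_submodule[OF assms(3)])
next
  assume iso: "mod_isomorphic R M N"
  show "Red_injective R S M \<longleftrightarrow> Red_injective R S N"
    using Red_injective_codomain_iso[OF assms(4) iso]
      Red_injective_codomain_iso[OF assms(3) mod_isomorphic_sym[OF assms(4) iso]] by (rule iffI)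
next
  assume iso: "mod_isomorphic R A B"
  show "Red_injective R A C \<longleftrightarrow> Red_injective R B C"
    \<comment> \<open>The transfer takes an isomorphism from the new domain to the old one, so
      passing from A to B uses the inverse and passing back uses the given map.\<close>
    using Red_injective_domain_iso[OF assms(5,6) mod_isomorphic_sym[OF assms(5) iso]]
      Red_injective_domain_iso[OF assms(6,5) iso] by (rule iffI)
next
  fix H assume "direct_summand R H M" "Red_injective R K M"
  then show "Red_injective R K (M\<lparr>carrier := H\<rparr>)"
    by (rule Red_injective_direct_summand[OF assms(4)])
qed

end
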